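(* Let $X$ be a finite alphabet. Two elements $f,g\in Fin\mathcal{ISA}(X)$ are conjugate with respect to $\sim$ (in the semigroup $Fin\mathcal{ISA}(X)$) if and only if $fe_f$ and $ge_g$ are $Fin\mathcal{SA}(X)$-conjugate.
   Context: An initial (partial Mealy) automaton over a finite alphabet $X$ consists of a set $Q$ of internal states, a partial transition function $\varphi:Q\times X\to Q$, a partial output function $\psi:Q\times X\to X$ and an initial state $q_0\in Q$. Extend $\varphi$ to words by $\varphi(q,e)=q$ ($e$ the empty word), $\varphi(q,wx)=\varphi(\varphi(q,w),x)$. The automaton defines the partial transformation of the set $X^*$ of all words over $X$ sending $u=x_1x_2x_3\dots$ to $\psi(q_0,x_1)\psi(\varphi(q_0,x_1),x_2)\psi(\varphi(q_0,x_1x_2),x_3)\dots$, undefined iff at least one of the values of $\varphi$ or $\psi$ in this expression is undefined. A partial automatic permutation is an injective partial transformation of $X^*$ defined in this way; these form an inverse semigroup $\mathcal{ISA}(X)$ under composition. An element $g\in\mathcal{ISA}(X)$ is finitary if there is $l\ge 0$ such that for every word $x_1x_2\dots$ in the domain of $g$, with image $y_1y_2\dots$, one has $x_i=y_i$ for all $i\geq l$. $Fin\mathcal{ISA}(X)$ is the inverse subsemigroup of all finitary elements; its group of units is $Fin\mathcal{SA}(X)$, the group of all everywhere defined elements of $Fin\mathcal{ISA}(X)$. Every element $f$ of $Fin\mathcal{ISA}(X)$ has a power lying in a subgroup; $e_f$ denotes the identity element of the group $H_{f^t}$ (the $\mathcal{H}$-class of $f^t$ for Green's relation $\mathcal{H}$),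 where $t\ge 1$ is such that $H_{f^t}$ is a group; this does not depend on $t$. In a semigroup $S$ write $a\sim_p b$ if $a=xy$, $b=yx$ for some $x,y\in S$; $\sim$ is the transitive closure of $\sim_p$. Elements $a,b$ are $Fin\mathcal{SA}(X)$-conjugate if $a=h^{-1}bh$ for some $h\in Fin\mathcal{SA}(X)$. *)

theory Defs
  imports "HOL-Algebra.Coset"
begin

record ('q, 'x) automaton =
  states :: "'q set"
  trans :: "'q \<Rightarrow> 'x \<Rightarrow> 'q option"
  out :: "'q \<Rightarrow> 'x \<Rightarrow> 'x option"
  init :: 'q

definition wf_automaton :: "('q, 'x) automaton \<Rightarrow> bool" where
  "wf_automaton A \<longleftrightarrow>
     init A \<in> states A \<and> (\<forall>q\<in>states A. \<forall>x p. trans A q x = Some p \<longrightarrow> p \<in> states A)"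

definition trans_word :: "('q, 'x) automaton \<Rightarrow> 'q \<Rightarrow> 'x list \<Rightarrow> 'q option" where
  "trans_word A q w = foldl (\<lambda>s x. Option.bind s (\<lambda>p. trans A p x)) (Some q) w"

text \<open>
  The output on a word of length \<open>n\<close> involves the states reached after its proper prefixes
  only; the transition on the last letter may be undefined.
\<close>

definition automaton_map :: "('q, 'x) automaton \<Rightarrow> 'x list \<Rightarrow> 'x list option" where
  "automaton_map A u =
     those (map (\<lambda>i. Option.bind (trans_word A (init A) (take i u)) (\<lambda>q. out A q (u ! i)))
                [0..<length u])"

text \<open>
  States of an automaton are taken from the type of words over the alphabet. This is no
  restriction: see \<open>automaton_map_realizable\<close> below.
\<close>

definition automatic :: "('x list \<Rightarrow> 'x list option) \<Rightarrow> bool" where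
  "automatic f \<longleftrightarrow> (\<exists>A :: ('x list, 'x) automaton. wf_automaton A \<and> f = automaton_map A)"

lemma trans_word_simps [simp]:
  "trans_word A q [] = Some q"
  "trans_word A q (w @ [x]) = Option.bind (trans_word A q w) (\<lambda>p. trans A p x)"
  by (simp_all add: trans_word_def)

lemma automaton_map_realizable:
  fixes A :: "('q, 'x) automaton"
  shows "automatic (automaton_map A)"
proof -
  define s where "s w = trans_word A (init A) w" for w
  define B :: "('x list, 'x) automaton" where
    "B = \<lparr>states = UNIV,
          trans = (\<lambda>w x. if s (w @ [x]) = None then None else Some (w @ [x])),
          out = (\<lambda>w x. Option.bind (s w) (\<lambda>q. out A q x)),
          init = []\<rparr>"
  have tw: "trans_word B [] w = (if s w = None then None else Some w)" for w
    by (induction w rule: rev_induct) (auto simp: B_def s_def)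
  have "automaton_map A = automaton_map B"
  proof
    fix u
    have "Option.bind (trans_word A (init A) (take i u)) (\<lambda>q. out A q (u ! i)) =
          Option.bind (trans_word B (init B) (take i u)) (\<lambda>q. out B q (u ! i))" for i
    proof -
      have "init B = []" by (simp add: B_def)
      then show ?thesis
        using tw[of "take i u"] by (auto simp: B_def s_def)
    qed
    then show "automaton_map A u = automaton_map B u"
      by (simp add: automaton_map_def)
  qed
  moreover have "wf_automaton B"
    by (simp add: wf_automaton_def B_def)
  ultimately show ?thesis
    unfolding automatic_def by blast
qed

text \<open>
  Maps act on the left, i.e. the product is \<open>f \<circ>\<^sub>m g\<close> (first \<open>g\<close>, then \<open>f\<close>). The opposite
  convention yields the opposite semigroup.
\<close>

definition ISA :: "('x list \<Rightarrow> 'x list option) monoid" where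
  "ISA = \<lparr>carrier = {f. automatic f \<and> inj_on f (dom f)}, mult = (\<circ>\<^sub>m), one = Some\<rparr>"

definition finitary :: "('x list \<Rightarrow> 'x list option) \<Rightarrow> bool" where
  "finitary g \<longleftrightarrow> (\<exists>l. \<forall>u v. g u = Some v \<longrightarrow> (\<forall>i. l \<le> i \<and> i < length u \<longrightarrow> u ! i = v ! i))"

definition FinISA :: "('x list \<Rightarrow> 'x list option) monoid" where
  "FinISA = ISA\<lparr>carrier := {g \<in> carrier ISA. finitary g}\<rparr>"

definition FinSA :: "('x list \<Rightarrow> 'x list option) monoid" where
  "FinSA = FinISA\<lparr>carrier := {g \<in> carrier FinISA. dom g = UNIV}\<rparr>"

definition FinSA_conjugate ::
    "('x list \<Rightarrow> 'x list option) \<Rightarrow> ('x list \<Rightarrow> 'x list option) \<Rightarrow> bool" where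
  "FinSA_conjugate a b \<longleftrightarrow>
     (\<exists>h\<in>carrier FinSA. a = inv\<^bsub>FinSA\<^esub> h \<otimes>\<^bsub>FinISA\<^esub> b \<otimes>\<^bsub>FinISA\<^esub> h)"

definition primary_conjugate :: "('a, 'm) monoid_scheme \<Rightarrow> 'a \<Rightarrow> 'a \<Rightarrow> bool" where
  "primary_conjugate S a b \<longleftrightarrow>
     (\<exists>x\<in>carrier S. \<exists>y\<in>carrier S. a = x \<otimes>\<^bsub>S\<^esub> y \<and> b = y \<otimes>\<^bsub>S\<^esub> x)"

definition semigroup_conjugate :: "('a, 'm) monoid_scheme \<Rightarrow> 'a \<Rightarrow> 'a \<Rightarrow> bool" where
  "semigroup_conjugate S = (primary_conjugate S)\<^sup>+\<^sup>+"

text \<open>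
  The coset operations of the library are applied to the whole carrier, so they denote
  the principal one-sided ideals \<open>S a\<close> and \<open>a S\<close>; as \<open>S\<close> has an identity,
  these equal \<open>S\<^sup>1 a\<close> and \<open>a S\<^sup>1\<close>.
\<close>

definition green_H :: "('a, 'm) monoid_scheme \<Rightarrow> 'a \<Rightarrow> 'a \<Rightarrow> bool" where
  "green_H S a b \<longleftrightarrow>
     carrier S #>\<^bsub>S\<^esub> a = carrier S #>\<^bsub>S\<^esub> b \<and> a <#\<^bsub>S\<^esub> carrier S = b <#\<^bsub>S\<^esub> carrier S"

definition H_class :: "('a, 'm) monoid_scheme \<Rightarrow> 'a \<Rightarrow> 'a set" where
  "H_class S a = {b \<in> carrier S. green_H S a b}"

text \<open>
  The identity element \<open>e\<close> of the group \<open>H_class S (f\<^sup>t)\<close> is in general not the identity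
  of \<open>S\<close>, hence the update of the \<open>one\<close> field. The value is meaningful only if
  \<open>f\<close> has a power, with positive exponent, whose H-class is a group; \<open>e\<close> then is unique.
\<close>

definition idem_of :: "('a, 'm) monoid_scheme \<Rightarrow> 'a \<Rightarrow> 'a" where
  "idem_of S f =
     (THE e. \<exists>t::nat. t \<ge> 1 \<and> group (S\<lparr>carrier := H_class S (f [^]\<^bsub>S\<^esub> t), one := e\<rparr>))"

end

theory Submission
  imports Defs
begin

text \<open>
  An element of \<open>FinISA\<close> is an isomorphism between two rooted subtrees of the tree of all words
  that, below some level, copies the letters (\<open>FinISA_iff\<close>).  The orbit of a word under \<open>f\<close> thus
  stays in a finite set whose size is bounded independently of the word, so an injective \<open>f\<close>
  either runs the word out of its domain within a bounded number of steps or moves it along a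
  cycle of bounded length.  Hence some power of \<open>f\<close> is idempotent
  (\<open>FinISA_idempotent_power\<close>), and in any monoid \<open>idem_of\<close> then returns that power
  (\<open>idem_of_eq_idempotent_power\<close>).  Here it is the partial identity \<open>e\<^sub>f\<close> on the subtree of
  periodic words, and \<open>f e\<^sub>f\<close> is the permutation that \<open>f\<close> induces on this subtree.

  If \<open>f = x y\<close> and \<open>g = y x\<close>, then \<open>y\<close> maps the periodic words of \<open>f\<close> bijectively onto those of
  \<open>g\<close> and intertwines the two permutations (\<open>idempotent_power_intertwiner\<close>).  What makes the
  group of units sufficient is that an isomorphism between subtrees extends to an automorphism of
  the whole tree, one vertex at a time, because at each vertex a partial injection of the finite
  alphabet extends to a permutation (\<open>FinISA_extends_to_FinSA\<close>).  The extension conjugates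
  \<open>f e\<^sub>f\<close> to \<open>g e\<^sub>g\<close>.

  Conversely, conjugacy by a unit is a special case of \<open>primary_conjugate\<close>, so it remains to link
  \<open>f\<close> with \<open>f e\<^sub>f\<close>.  Let \<open>d\<^sub>n\<close> be the partial identity on the domain of \<open>f\<^sup>n\<close>.  Since
  \<open>d\<^sub>n f = f d\<^sub>n\<^sub>+\<^sub>1\<close>, swapping the two factors of \<open>f d\<^sub>n\<close> gives \<open>f d\<^sub>n\<^sub>+\<^sub>1\<close>.  This
  leads from \<open>f = f d\<^sub>0\<close> to \<open>f d\<^sub>t\<close>, which is \<open>f e\<^sub>f\<close> once \<open>f\<^sup>t\<close> is idempotent
  (\<open>semigroup_conjugate_idempotent_power\<close>).
\<close>

section \<open>Idempotent powers in monoids\<close>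

context monoid
begin

text \<open>
  The elements of this class are the units of the local monoid \<open>e G e\<close>; in this form they are
  seen to be a group.
\<close>

lemma H_class_idempotent_iff:
  assumes e: "e \<in> carrier G" "e \<otimes> e = e"
  shows "b \<in> H_class G e \<longleftrightarrow> b \<in> carrier G \<and> b \<otimes> e = b \<and> e \<otimes> b = b \<and>
           (\<exists>c\<in>carrier G. c \<otimes> b = e) \<and> (\<exists>d\<in>carrier G. b \<otimes> d = e)"
    (is "?L \<longleftrightarrow> ?R")
proof
  assume ?L
  then have b: "b \<in> carrier G" and l: "carrier G #> e = carrier G #> b"
    and r: "e <# carrier G = b <# carrier G"
    by (auto simp: H_class_def green_H_def)
  have "\<one> \<otimes> b \<in> carrier G #> b" "\<one> \<otimes> e \<in> carrier G #> e"
    "b \<otimes> \<one> \<in> b <# carrier G" "e \<otimes> \<one> \<in> e <# carrier G"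
    unfolding r_coset_def l_coset_def by blast+
  then have "b \<in> carrier G #> e" "e \<in> carrier G #> b" "b \<in> e <# carrier G" "e \<in> b <# carrier G"
    using l r b e by simp_all
  then obtain p c q d where *: "p \<in> carrier G" "c \<in> carrier G" "q \<in> carrier G" "d \<in> carrier G"
    "b = p \<otimes> e" "e = c \<otimes> b" "b = e \<otimes> q" "e = b \<otimes> d"
    unfolding r_coset_def l_coset_def by blast
  have "b \<otimes> e = b"
    using * e by (metis m_assoc)
  moreover have "e \<otimes> b = b"
    using * e by (metis m_assoc)
  ultimately show ?R
    using * b by metis
next
  assume R: ?R
  then obtain c d where cd: "c \<in> carrier G" "d \<in> carrier G" "c \<otimes> b = e" "b \<otimes> d = e"
    by blast
  have b: "b \<in> carrier G" "b \<otimes> e = b" "e \<otimes> b = b"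
    using R by auto
  have "carrier G #> e = carrier G #> b"
  proof -
    have "s \<otimes> e = (s \<otimes> c) \<otimes> b" "s \<otimes> b = (s \<otimes> b) \<otimes> e" if "s \<in> carrier G" for s
      using that b cd e by (simp_all add: m_assoc)
    then show ?thesis
      unfolding r_coset_def using b cd e by (auto; metis m_closed)
  qed
  moreover have "e <# carrier G = b <# carrier G"
  proof -
    have "e \<otimes> s = b \<otimes> (d \<otimes> s)" "b \<otimes> s = e \<otimes> (b \<otimes> s)" if "s \<in> carrier G" for s
      using that b cd e by (simp_all flip: m_assoc)
    then show ?thesis
      unfolding l_coset_def using b cd e by (auto; metis m_closed)
  qed
  ultimately show ?L
    using b by (simp add: H_class_def green_H_def)
qed

lemma group_H_class_idempotent:
  assumes e: "e \<in> carrier G" "e \<otimes> e = e"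
  shows "group (G\<lparr>carrier := H_class G e, one := e\<rparr>)"
proof (rule groupI)
  note iff = H_class_idempotent_iff[OF e]
  fix a assume "a \<in> carrier (G\<lparr>carrier := H_class G e, one := e\<rparr>)"
  then have a: "a \<in> H_class G e"
    by simp
  then obtain c d where a': "a \<in> carrier G" "a \<otimes> e = a" "e \<otimes> a = a" and
    cd: "c \<in> carrier G" "d \<in> carrier G" "c \<otimes> a = e" "a \<otimes> d = e"
    using iff by blast
  show "\<one>\<^bsub>G\<lparr>carrier := H_class G e, one := e\<rparr>\<^esub> \<otimes>\<^bsub>G\<lparr>carrier := H_class G e, one := e\<rparr>\<^esub> a = a"
    using a' by simp
  \<comment> \<open>Cutting the one-sided inverses \<open>c\<close> and \<open>d\<close> down by \<open>e\<close> makes them agree.\<close>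
  define c' where "c' = e \<otimes> c \<otimes> e"
  define d' where "d' = e \<otimes> d \<otimes> e"
  have c': "c' \<in> carrier G" "c' \<otimes> a = e" "c' \<otimes> e = c'" "e \<otimes> c' = c'"
    using e a' cd by (simp_all add: c'_def m_assoc) (simp_all flip: m_assoc add: e)
  have d': "d' \<in> carrier G" "a \<otimes> d' = e" "e \<otimes> d' = d'"
    using e a' cd by (simp_all add: d'_def flip: m_assoc)
  have "c' = d'"
    using c' d' a' by (metis m_assoc)
  then have "c' \<in> H_class G e"
    unfolding iff using c' d' a' by blast
  then show "\<exists>y\<in>carrier (G\<lparr>carrier := H_class G e, one := e\<rparr>).
      y \<otimes>\<^bsub>G\<lparr>carrier := H_class G e, one := e\<rparr>\<^esub> a = \<one>\<^bsub>G\<lparr>carrier := H_class G e, one := e\<rparr>\<^esub>"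
    using c' by auto
  fix b assume "b \<in> carrier (G\<lparr>carrier := H_class G e, one := e\<rparr>)"
  then obtain p q where b': "b \<in> carrier G" "b \<otimes> e = b" "e \<otimes> b = b" and
    pq: "p \<in> carrier G" "q \<in> carrier G" "p \<otimes> b = e" "b \<otimes> q = e"
    using iff by auto
  have "(p \<otimes> c) \<otimes> (a \<otimes> b) = p \<otimes> ((c \<otimes> a) \<otimes> b)"
    by (simp only: m_assoc m_closed a'(1) b'(1) cd(1) pq(1))
  then have 1: "(p \<otimes> c) \<otimes> (a \<otimes> b) = e"
    using a' b' cd pq by simp
  have "(a \<otimes> b) \<otimes> (q \<otimes> d) = a \<otimes> ((b \<otimes> q) \<otimes> d)"
    by (simp only: m_assoc m_closed a'(1) b'(1) cd(2) pq(2))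
  also have "\<dots> = e"
    using a' b' cd pq e by (simp flip: m_assoc)
  finally have 2: "(a \<otimes> b) \<otimes> (q \<otimes> d) = e" .
  have "a \<otimes> b \<otimes> e = a \<otimes> b" "e \<otimes> (a \<otimes> b) = a \<otimes> b"
    using a' b' e by (simp add: m_assoc, simp flip: m_assoc)
  then have "a \<otimes> b \<in> H_class G e"
    unfolding iff using a' b' cd pq 1 2 by (metis m_closed)
  then show "a \<otimes>\<^bsub>G\<lparr>carrier := H_class G e, one := e\<rparr>\<^esub> b \<in> carrier (G\<lparr>carrier := H_class G e, one := e\<rparr>)"
    by simp
next
  show "\<one>\<^bsub>G\<lparr>carrier := H_class G e, one := e\<rparr>\<^esub> \<in> carrier (G\<lparr>carrier := H_class G e, one := e\<rparr>)"
    using e by (simp add: H_class_def green_H_def)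
qed (auto simp: H_class_def m_assoc)

lemma idempotent_nat_pow:
  assumes "e \<in> carrier G" "e \<otimes> e = e" "n \<ge> (1::nat)"
  shows "e [^] n = e"
  using assms(3) by (induction n rule: dec_induct) (use assms in simp_all)

text \<open>
  If the \<open>\<H>\<close>-class of another power \<open>f\<^sup>s\<close> is a group as well, then it contains
  \<open>(f\<^sup>s)\<^sup>t = (f\<^sup>t)\<^sup>s = f\<^sup>t\<close>, and a group has only one idempotent.
\<close>

lemma idem_of_eq_idempotent_power:
  assumes f: "f \<in> carrier G" and t: "t \<ge> (1::nat)" and idem: "f [^] t \<otimes> f [^] t = f [^] t"
  shows "idem_of G f = f [^] t"
  unfolding idem_of_def
proof (rule the_equality)
  show "\<exists>s::nat. s \<ge> 1 \<and> group (G\<lparr>carrier := H_class G (f [^] s), one := f [^] t\<rparr>)"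
    using group_H_class_idempotent[OF _ idem] f t by auto
next
  fix e assume "\<exists>s::nat. s \<ge> 1 \<and> group (G\<lparr>carrier := H_class G (f [^] s), one := e\<rparr>)"
  then obtain s :: nat where s: "s \<ge> 1"
    and group: "group (G\<lparr>carrier := H_class G (f [^] s), one := e\<rparr>)" (is "group ?K")
    by blast
  interpret K: group ?K by (rule group)
  have self: "f [^] s \<in> H_class G (f [^] s)"
    using f by (simp add: H_class_def green_H_def)
  have "(f [^] s) [^] n \<in> H_class G (f [^] s)" if "n \<ge> 1" for n :: nat
    using that
  proof (induction n rule: dec_induct)
    case base
    then show ?case using self f by simp
  next
    case (step n)
    then show ?case using K.m_closed[of "(f [^] s) [^] n" "f [^] s"] self by simp
  qed
  from this[OF t] have "f [^] t \<in> H_class G (f [^] s)"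
    using idempotent_nat_pow[OF _ idem s] f by (simp add: nat_pow_pow mult.commute)
  then show "e = f [^] t"
    using K.l_cancel_one[of "f [^] t" "f [^] t"] idem by simp
qed

lemma nat_pow_shift:
  assumes "x \<in> carrier G" "y \<in> carrier G"
  shows "(x \<otimes> y) [^] (n::nat) \<otimes> x = x \<otimes> (y \<otimes> x) [^] n"
proof (induction n)
  case (Suc n)
  have "(x \<otimes> y) [^] Suc n \<otimes> x = ((x \<otimes> y) [^] n \<otimes> x) \<otimes> (y \<otimes> x)"
    using assms by (simp add: m_assoc)
  also have "\<dots> = x \<otimes> (y \<otimes> x) [^] Suc n"
    using assms by (simp add: Suc m_assoc)
  finally show ?case .
qed (use assms in simp)

text \<open>
  The intertwiner is \<open>p = y e\<close>.  The element \<open>z = x (y x)\<^sup>t\<^sup>-\<^sup>1\<close> is an inverse of it relative to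
  \<open>e\<close> and \<open>e'\<close>, because \<open>y z\<close> is the \<open>t\<close>-th power of \<open>y x\<close>, and \<open>z y\<close> is that of \<open>x y\<close>.
\<close>

lemma idempotent_power_intertwiner:
  assumes x: "x \<in> carrier G" and y: "y \<in> carrier G" and t: "t \<ge> (1::nat)"
    and e: "e = (x \<otimes> y) [^] t" "e \<otimes> e = e"
    and e': "e' = (y \<otimes> x) [^] t" "e' \<otimes> e' = e'"
  obtains p z where "p \<in> carrier G" "z \<in> carrier G" "p \<otimes> e = p" "e' \<otimes> p = p"
    "z \<otimes> p = e" "p \<otimes> z = e'" "(y \<otimes> x) \<otimes> p = p \<otimes> (x \<otimes> y)"
proof -
  obtain n where n: "t = Suc n"
    using t by (cases t) auto
  define z where "z = x \<otimes> (y \<otimes> x) [^] n"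
  have ec: "e \<in> carrier G" "e' \<in> carrier G" and zc: "z \<in> carrier G"
    using x y e(1) e'(1) by (auto simp: z_def)
  have shift: "y \<otimes> e = e' \<otimes> y"
    using nat_pow_shift[OF y x, of t] e(1) e'(1) by simp
  have zy: "z \<otimes> y = e"
    using nat_pow_shift[OF x y, of n] x y e(1) by (simp add: z_def n m_assoc flip: nat_pow_Suc2)
       (simp add: m_assoc[symmetric])
  have yz: "y \<otimes> z = e'"
    using x y nat_pow_Suc2[of "y \<otimes> x" n] by (simp add: z_def e'(1) n m_assoc)
  have comm: "e \<otimes> (x \<otimes> y) = (x \<otimes> y) \<otimes> e"
    using nat_pow_comm[of "x \<otimes> y" t 1] x y e(1) by simp
  show thesis
  proof (rule that[of "y \<otimes> e" z])
    show "y \<otimes> e \<otimes> e = y \<otimes> e"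
      using y ec e by (simp add: m_assoc)
    show "e' \<otimes> (y \<otimes> e) = y \<otimes> e"
      using y ec e(2) by (metis shift m_assoc)
    show "z \<otimes> (y \<otimes> e) = e"
      using zc y ec e zy by (simp flip: m_assoc)
    show "y \<otimes> e \<otimes> z = e'"
      using zc y ec e' yz by (simp add: shift m_assoc)
    have "y \<otimes> x \<otimes> (y \<otimes> e) = y \<otimes> ((x \<otimes> y) \<otimes> e)"
      using x y ec by (simp add: m_assoc)
    then show "y \<otimes> x \<otimes> (y \<otimes> e) = y \<otimes> e \<otimes> (x \<otimes> y)"
      using x y ec by (simp add: m_assoc flip: comm)
  qed (use y ec zc in auto)
qed

end

section \<open>Automatic maps as tree maps\<close>

definition tree_map :: "('x list \<Rightarrow> 'x list option) \<Rightarrow> bool" where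
  "tree_map f \<longleftrightarrow> f [] = Some [] \<and>
     (\<forall>u x w. f (u @ [x]) = Some w \<longrightarrow> (\<exists>v y. f u = Some v \<and> w = v @ [y]))"

lemma those_append:
  "those (xs @ ys) = Option.bind (those xs) (\<lambda>us. map_option (\<lambda>vs. us @ vs) (those ys))"
proof (induction xs)
  case Nil
  show ?case by (cases "those ys") auto
next
  case (Cons x xs)
  then show ?case by (cases x; cases "those xs"; cases "those ys") auto
qed

lemma automaton_map_Nil: "automaton_map A [] = Some []"
  by (simp add: automaton_map_def)

lemma automaton_map_snoc:
  "automaton_map A (u @ [x]) =
     Option.bind (automaton_map A u) (\<lambda>v.
       map_option (\<lambda>y. v @ [y]) (Option.bind (trans_word A (init A) u) (\<lambda>q. out A q x)))"
proof -
  have "map (\<lambda>i. Option.bind (trans_word A (init A) (take i (u @ [x]))) (\<lambda>q. out A q ((u @ [x]) ! i)))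
             [0..<length (u @ [x])] =
        map (\<lambda>i. Option.bind (trans_word A (init A) (take i u)) (\<lambda>q. out A q (u ! i))) [0..<length u]
          @ [Option.bind (trans_word A (init A) u) (\<lambda>q. out A q x)]"
    by (simp add: nth_append)
  then have "automaton_map A (u @ [x]) =
      those (map (\<lambda>i. Option.bind (trans_word A (init A) (take i u)) (\<lambda>q. out A q (u ! i))) [0..<length u]
        @ [Option.bind (trans_word A (init A) u) (\<lambda>q. out A q x)])"
    unfolding automaton_map_def by (rule arg_cong)
  then show ?thesis
    by (cases "Option.bind (trans_word A (init A) u) (\<lambda>q. out A q x)")
       (simp_all add: automaton_map_def those_append)
qed

text \<open>For the converse direction, the automaton whose states are the words read so far will do.\<close>

lemma automatic_iff_tree_map: "automatic f \<longleftrightarrow> tree_map f"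
proof
  assume "automatic f"
  then obtain A :: "('a list, 'a) automaton" where "f = automaton_map A"
    by (auto simp: automatic_def)
  then show "tree_map f"
    by (auto simp: tree_map_def automaton_map_Nil automaton_map_snoc bind_eq_Some_conv)
next
  assume f: "tree_map f"
  define A :: "('a list, 'a) automaton" where
    "A = \<lparr>states = UNIV, trans = (\<lambda>u x. Some (u @ [x])),
          out = (\<lambda>u x. map_option last (f (u @ [x]))), init = []\<rparr>"
  have state: "trans_word A (init A) u = Some u" for u
    by (induction u rule: rev_induct) (simp_all add: A_def)
  have "automaton_map A u = f u" for u
  proof (induction u rule: rev_induct)
    case Nil
    then show ?case using f by (simp add: automaton_map_Nil tree_map_def)
  next
    case (snoc x u)
    show ?case
    proof (cases "f (u @ [x])")
      case None
      then show ?thesis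
        by (simp add: automaton_map_snoc state) (simp add: A_def bind_eq_None_conv)
    next
      case (Some w)
      then obtain v y where "f u = Some v" "w = v @ [y]"
        using f unfolding tree_map_def by blast
      with Some snoc show ?thesis
        by (simp add: automaton_map_snoc state) (simp add: A_def)
    qed
  qed
  then have "f = automaton_map A" by auto
  moreover have "wf_automaton A" by (simp add: wf_automaton_def A_def)
  ultimately show "automatic f" unfolding automatic_def by blast
qed

lemma tree_map_length:
  assumes "tree_map f" "f u = Some v"
  shows "length v = length u"
  using assms(2)
proof (induction u arbitrary: v rule: rev_induct)
  case Nil
  then show ?case using assms(1) by (simp add: tree_map_def)
next
  case (snoc x u)
  then obtain v' y where "f u = Some v'" "v = v' @ [y]"
    using assms(1) unfolding tree_map_def by blast
  with snoc.IH show ?case by simp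
qed

lemma finitary_iff_drop:
  assumes "tree_map f"
  shows "finitary f \<longleftrightarrow> (\<exists>l. \<forall>u v. f u = Some v \<longrightarrow> drop l v = drop l u)"
proof -
  have "(\<forall>i. l \<le> i \<and> i < length u \<longrightarrow> u ! i = v ! i) \<longleftrightarrow> drop l v = drop l u"
    if "length v = length u" for l and u v :: "'a list"
  proof
    assume *: "\<forall>i. l \<le> i \<and> i < length u \<longrightarrow> u ! i = v ! i"
    show "drop l v = drop l u"
      by (rule nth_equalityI) (use * that in auto)
  next
    assume eq: "drop l v = drop l u"
    show "\<forall>i. l \<le> i \<and> i < length u \<longrightarrow> u ! i = v ! i"
    proof (intro allI impI)
      fix i assume "l \<le> i \<and> i < length u"
      then show "u ! i = v ! i"
        using arg_cong[OF eq, of "\<lambda>w. w ! (i - l)"] that by simp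
    qed
  qed
  then show ?thesis
    unfolding finitary_def using tree_map_length[OF assms] by blast
qed

lemma FinISA_iff:
  "f \<in> carrier FinISA \<longleftrightarrow>
     tree_map f \<and> inj_on f (dom f) \<and> (\<exists>l. \<forall>u v. f u = Some v \<longrightarrow> drop l v = drop l u)"
  using finitary_iff_drop[of f] by (simp add: FinISA_def ISA_def automatic_iff_tree_map) blast

lemma FinISA_mult [simp]: "f \<otimes>\<^bsub>FinISA\<^esub> g = f \<circ>\<^sub>m g"
  by (simp add: FinISA_def ISA_def)

lemma FinISA_one [simp]: "\<one>\<^bsub>FinISA\<^esub> = Some"
  by (simp add: FinISA_def ISA_def)

lemma FinSA_iff: "h \<in> carrier FinSA \<longleftrightarrow> h \<in> carrier FinISA \<and> (\<forall>u. h u \<noteq> None)"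
  by (auto simp: FinSA_def)

lemma FinSA_mult [simp]: "f \<otimes>\<^bsub>FinSA\<^esub> g = f \<circ>\<^sub>m g"
  by (simp add: FinSA_def)

lemma FinSA_one [simp]: "\<one>\<^bsub>FinSA\<^esub> = Some"
  by (simp add: FinSA_def)

lemma FinISA_inj:
  assumes "f \<in> carrier FinISA" "f u = Some w" "f v = Some w"
  shows "u = v"
  using assms by (auto simp: FinISA_iff inj_on_def dom_def)

lemma map_comp_assoc: "(f \<circ>\<^sub>m g) \<circ>\<^sub>m h = f \<circ>\<^sub>m (g \<circ>\<^sub>m h)"
  by (rule ext) (simp add: map_comp_def split: option.splits)

lemma Some_map_comp [simp]: "Some \<circ>\<^sub>m f = f" "f \<circ>\<^sub>m Some = f"
  by (rule ext, simp add: map_comp_def split: option.splits)+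

lemma FinISA_comp_closed:
  assumes f: "f \<in> carrier FinISA" and g: "g \<in> carrier FinISA"
  shows "f \<circ>\<^sub>m g \<in> carrier FinISA"
proof -
  have tf: "tree_map f" and tg: "tree_map g"
    using f g by (auto simp: FinISA_iff)
  have "tree_map (f \<circ>\<^sub>m g)"
    unfolding tree_map_def
  proof (intro conjI allI impI)
    show "(f \<circ>\<^sub>m g) [] = Some []"
      using tf tg by (simp add: tree_map_def)
    fix u x w assume "(f \<circ>\<^sub>m g) (u @ [x]) = Some w"
    then obtain v where v: "g (u @ [x]) = Some v" "f v = Some w"
      by (auto simp: map_comp_Some_iff)
    then obtain v' y where v': "g u = Some v'" "v = v' @ [y]"
      using tg unfolding tree_map_def by blast
    with v obtain w' z where "f v' = Some w'" "w = w' @ [z]"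
      using tf unfolding tree_map_def by blast
    with v' show "\<exists>v y. (f \<circ>\<^sub>m g) u = Some v \<and> w = v @ [y]"
      by simp
  qed
  moreover have "inj_on (f \<circ>\<^sub>m g) (dom (f \<circ>\<^sub>m g))"
  proof (rule inj_onI)
    fix u v assume "u \<in> dom (f \<circ>\<^sub>m g)" "(f \<circ>\<^sub>m g) u = (f \<circ>\<^sub>m g) v"
    then obtain w where "(f \<circ>\<^sub>m g) u = Some w" "(f \<circ>\<^sub>m g) v = Some w"
      by force
    then show "u = v"
      unfolding map_comp_Some_iff using FinISA_inj[OF f] FinISA_inj[OF g] by blast
  qed
  moreover have "\<exists>l. \<forall>u v. (f \<circ>\<^sub>m g) u = Some v \<longrightarrow> drop l v = drop l u"
  proof -
    obtain k l where k: "\<And>u v. f u = Some v \<Longrightarrow> drop k v = drop k u"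
      and l: "\<And>u v. g u = Some v \<Longrightarrow> drop l v = drop l u"
      using f g unfolding FinISA_iff by blast
    have "drop (k + l) v = drop (k + l) u" if "(f \<circ>\<^sub>m g) u = Some v" for u v
      using that by (auto simp: map_comp_Some_iff) (metis k l add.commute drop_drop)
    then show ?thesis by blast
  qed
  ultimately show ?thesis
    by (simp add: FinISA_iff)
qed

lemma partial_identity_in_FinISA:
  assumes "[] \<in> D" "\<And>u x. u @ [x] \<in> D \<Longrightarrow> u \<in> D"
  shows "Some |` D \<in> carrier FinISA"
proof -
  have "tree_map (Some |` D)"
    using assms by (auto simp: tree_map_def restrict_map_def split: if_splits)
  moreover have "inj_on (Some |` D) (dom (Some |` D))"
    by (auto simp: inj_on_def)
  ultimately show ?thesis
    by (auto simp: FinISA_iff restrict_map_def split: if_splits)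
qed

lemma Some_in_FinISA: "Some \<in> carrier FinISA"
  using partial_identity_in_FinISA[of UNIV] by (simp add: restrict_map_def)

interpretation FinISA: monoid FinISA
  by (rule monoidI) (simp_all add: FinISA_comp_closed Some_in_FinISA map_comp_assoc)

text \<open>An injective idempotent fixes its values, hence by injectivity also its arguments.\<close>

lemma FinISA_idempotent_fixes:
  assumes "e \<in> carrier FinISA" "e \<circ>\<^sub>m e = e" "e u = Some v"
  shows "v = u"
proof -
  have "e v = Some v"
    using assms(2,3) by (metis map_comp_simps(2))
  then show ?thesis
    using FinISA_inj assms(1,3) by blast
qed

text \<open>Words of a fixed length form a finite set, which \<open>h\<close> maps into itself.\<close>

lemma FinSA_surj:
  fixes h :: "('x::finite) list \<Rightarrow> 'x list option"
  assumes h: "h \<in> carrier FinSA"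
  shows "\<exists>u. h u = Some v"
proof -
  define W where "W = {u::'x list. length u = length v}"
  define k where "k u = the (h u)" for u
  have hk: "h u = Some (k u)" for u
    using h by (auto simp: FinSA_iff k_def)
  have H: "h \<in> carrier FinISA"
    using h by (simp add: FinSA_iff)
  then have len: "length (k u) = length u" for u
    using tree_map_length hk by (auto simp: FinISA_iff)
  have "finite W"
    using finite_lists_length_eq[of "UNIV :: 'x set" "length v"] by (simp add: W_def)
  moreover have "inj_on k W"
    by (rule inj_onI) (metis FinISA_inj[OF H] hk)
  moreover have "k ` W \<subseteq> W"
    using len by (auto simp: W_def)
  ultimately have "k ` W = W"
    by (simp add: endo_inj_surj)
  then have "v \<in> k ` W"
    by (simp add: W_def)
  then show ?thesis
    using hk by auto
qed

lemma FinSA_left_inverse: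
  fixes h :: "('x::finite) list \<Rightarrow> 'x list option"
  assumes h: "h \<in> carrier FinSA"
  shows "\<exists>k\<in>carrier FinSA. k \<circ>\<^sub>m h = Some"
proof -
  have H: "h \<in> carrier FinISA" and total: "\<And>u. h u \<noteq> None"
    using h by (auto simp: FinSA_iff)
  then have tree: "tree_map h"
    by (simp add: FinISA_iff)
  define k where "k v = Some (SOME u. h u = Some v)" for v
  have k: "k v = Some u \<longleftrightarrow> h u = Some v" for u v
    using someI_ex[OF FinSA_surj[OF h, of v]] FinISA_inj[OF H] by (auto simp: k_def)
  have "tree_map k"
    unfolding tree_map_def
  proof (intro conjI allI impI)
    show "k [] = Some []"
      using tree by (simp add: k tree_map_def)
    fix v y w assume "k (v @ [y]) = Some w"
    then have w: "h w = Some (v @ [y])"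
      by (simp add: k)
    then have "w \<noteq> []"
      using tree by (auto simp: tree_map_def)
    then obtain u x where "w = u @ [x]"
      by (metis rev_exhaust)
    moreover from this w obtain v' y' where "h u = Some v'" "v @ [y] = v' @ [y']"
      using tree unfolding tree_map_def by blast
    ultimately show "\<exists>u x. k v = Some u \<and> w = u @ [x]"
      by (auto simp: k)
  qed
  moreover have "inj_on k (dom k)"
  proof (rule inj_onI)
    fix v v' assume "v \<in> dom k" "k v = k v'"
    then obtain u where "k v = Some u" "k v' = Some u"
      by force
    then show "v = v'" by (simp add: k)
  qed
  moreover have "\<exists>l. \<forall>v u. k v = Some u \<longrightarrow> drop l u = drop l v"
    using H by (auto simp: FinISA_iff k) metis
  ultimately have "k \<in> carrier FinSA"
    by (simp add: FinSA_iff FinISA_iff) (simp add: k_def)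
  moreover have "k \<circ>\<^sub>m h = Some"
    using total k by (auto simp: fun_eq_iff map_comp_Some_iff)
  ultimately show ?thesis by blast
qed

lemma group_FinSA: "group (FinSA :: (('x::finite) list \<Rightarrow> 'x list option) monoid)"
proof (rule groupI)
  fix f g :: "'x list \<Rightarrow> 'x list option"
  assume fg: "f \<in> carrier FinSA" "g \<in> carrier FinSA"
  then have "(f \<circ>\<^sub>m g) u \<noteq> None" for u
    by (auto simp: FinSA_iff map_comp_None_iff)
  with fg show "f \<otimes>\<^bsub>FinSA\<^esub> g \<in> carrier FinSA"
    by (simp add: FinSA_iff FinISA_comp_closed)
qed (simp_all add: FinSA_left_inverse map_comp_assoc FinSA_iff Some_in_FinISA)

interpretation FinSA: group "FinSA :: (('x::finite) list \<Rightarrow> 'x list option) monoid"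
  by (rule group_FinSA)

section \<open>Every element has an idempotent power\<close>

lemma FinISA_pow_tree_map:
  assumes "f \<in> carrier FinISA"
  shows "tree_map (f [^]\<^bsub>FinISA\<^esub> (n::nat))"
  using FinISA.nat_pow_closed[OF assms, of n] FinISA_iff by blast

text \<open>
  Only the first \<open>l\<close> letters of a word change along its orbit, so an orbit has at most as many
  points as there are words of length at most \<open>l\<close>.  With \<open>M\<close> this number, every word on which
  \<open>f\<^sup>M\<close> is defined returns after \<open>p \<le> M\<close> steps, and \<open>p\<close> divides \<open>M!\<close>.
\<close>

lemma FinISA_idempotent_power:
  fixes f :: "('x::finite) list \<Rightarrow> 'x list option"
  assumes f: "f \<in> carrier FinISA"
  obtains t :: nat where "t \<ge> 1"
    "(f [^]\<^bsub>FinISA\<^esub> t) \<circ>\<^sub>m (f [^]\<^bsub>FinISA\<^esub> t) = f [^]\<^bsub>FinISA\<^esub> t"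
proof -
  obtain l where l: "\<And>u v. f u = Some v \<Longrightarrow> drop l v = drop l u"
    using f unfolding FinISA_iff by blast
  define P where "P n = f [^]\<^bsub>FinISA\<^esub> n" for n :: nat
  have P_add: "P (m + n) = P m \<circ>\<^sub>m P n" for m n
    using FinISA.nat_pow_mult[OF f, of m n] by (simp add: P_def)
  have P0: "P 0 = Some" and P_Suc: "P (Suc n) = P n \<circ>\<^sub>m f" for n
    by (simp_all add: P_def)
  have P_closed: "P n \<in> carrier FinISA" for n
    using f by (simp add: P_def)
  have P_tail: "drop l v = drop l u" if "P n u = Some v" for n u v
    using that
  proof (induction n arbitrary: u)
    case (Suc n)
    then show ?case by (auto simp: P_Suc map_comp_Some_iff dest!: l)
  qed (simp add: P0)
  define W where "W = {w::'x list. length w \<le> l}"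
  define M where "M = card W"
  have "finite W"
    using finite_lists_length_le[of "UNIV :: 'x set" l] by (simp add: W_def)
  define t where "t = (fact M :: nat)"
  have "M \<le> t" "t \<ge> 1"
    by (auto simp: t_def fact_ge_self fact_ge_1)
  have fixed: "v = u" if tu: "P t u = Some v" for u v
  proof -
    have "\<exists>w. P i u = Some w" if "i \<le> M" for i
    proof -
      have "P t = P (t - i) \<circ>\<^sub>m P i"
        using that \<open>M \<le> t\<close> by (simp flip: P_add)
      then show ?thesis
        using tu by (auto simp: map_comp_Some_iff)
    qed
    then obtain orb where orb: "\<And>i. i \<le> M \<Longrightarrow> P i u = Some (orb i)"
      by metis
    have tail: "drop l (orb i) = drop l u" if "i \<le> M" for i
      using P_tail orb that by blast
    \<comment> \<open>\<open>{..M}\<close> has one more element than \<open>W\<close>.\<close>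
    have "\<not> inj_on (\<lambda>i. take l (orb i)) {..M}"
    proof
      assume "inj_on (\<lambda>i. take l (orb i)) {..M}"
      moreover have "(\<lambda>i. take l (orb i)) ` {..M} \<subseteq> W"
        by (auto simp: W_def)
      ultimately have "card {..M} \<le> card W"
        using \<open>finite W\<close> by (rule card_inj_on_le)
      then show False by (simp add: M_def)
    qed
    then obtain i j where ij: "i < j" "j \<le> M" "take l (orb i) = take l (orb j)"
      unfolding inj_on_def by (metis atMost_iff linorder_neqE_nat)
    then have "orb i = orb j"
      using tail[of i] tail[of j] by (metis append_take_drop_id less_imp_le_nat order_trans)
    define p where "p = j - i"
    have "P j = P i \<circ>\<^sub>m P p"
      using ij by (simp add: p_def flip: P_add)
    then obtain w where w: "P p u = Some w" "P i w = Some (orb j)"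
      using orb[of j] ij by (auto simp: map_comp_Some_iff)
    moreover have "P i u = Some (orb j)"
      using orb[of i] ij \<open>orb i = orb j\<close> by simp
    ultimately have pu: "P p u = Some u"
      using FinISA_inj[OF P_closed] by metis
    have "P (p * n) u = Some u" for n
      by (induction n) (simp_all add: P0 P_add pu)
    moreover have "p dvd t"
      using ij by (auto simp: t_def p_def intro!: dvd_fact)
    ultimately have "P t u = Some u"
      by (auto elim!: dvdE)
    with tu show ?thesis by simp
  qed
  have "P t \<circ>\<^sub>m P t = P t"
  proof
    fix u
    show "(P t \<circ>\<^sub>m P t) u = P t u"
      using fixed[of u] by (cases "P t u") auto
  qed
  then show thesis
    using that[OF \<open>t \<ge> 1\<close>] by (simp add: P_def)
qed

lemma FinISA_idem_of:
  assumes "f \<in> carrier FinISA" "t \<ge> (1::nat)"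
    "(f [^]\<^bsub>FinISA\<^esub> t) \<circ>\<^sub>m (f [^]\<^bsub>FinISA\<^esub> t) = f [^]\<^bsub>FinISA\<^esub> t"
  shows "idem_of FinISA f = f [^]\<^bsub>FinISA\<^esub> t"
  using FinISA.idem_of_eq_idempotent_power[OF assms(1,2)] assms(3) by simp

section \<open>Extending partial automorphisms\<close>

lemma partial_injection_extends:
  fixes p :: "'a::finite \<Rightarrow> 'a option"
  assumes "inj_on p (dom p)"
  obtains \<sigma> where "inj \<sigma>" "\<And>x y. p x = Some y \<Longrightarrow> \<sigma> x = y"
proof -
  define q where "q x = the (p x)" for x
  have inj: "inj_on q (dom p)"
    using assms by (auto simp: inj_on_def q_def dom_def)
  then have "card (- dom p) = card (- q ` dom p)"
    by (simp only: Compl_eq_Diff_UNIV card_Diff_subset finite subset_UNIV card_image)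
  then obtain r where r: "bij_betw r (- dom p) (- q ` dom p)"
    by (metis finite_same_card_bij finite)
  define \<sigma> where "\<sigma> x = (if x \<in> dom p then q x else r x)" for x
  have "inj \<sigma>"
  proof (rule injI)
    fix x x' assume eq: "\<sigma> x = \<sigma> x'"
    have off: "r z \<in> - q ` dom p" if "z \<notin> dom p" for z
      using r that unfolding bij_betw_def by blast
    have "inj_on r (- dom p)"
      using r by (simp add: bij_betw_def)
    then show "x = x'"
      using eq inj off[of x] off[of x'] unfolding \<sigma>_def inj_on_def
      by (cases "x \<in> dom p"; cases "x' \<in> dom p") (simp_all, force+)
  qed
  moreover have "\<sigma> x = y" if "p x = Some y" for x y
    using that by (auto simp: \<sigma>_def q_def)
  ultimately show thesis using that by blast
qed

text \<open>
  The extension is prescribed by a permutation \<open>\<sigma> u\<close> of the alphabet at every vertex \<open>u\<close>.  At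
  each vertex it extends the action of \<open>y\<close> on the edges below; from the level on where \<open>y\<close>
  copies letters, the identity does this, and choosing it there keeps the extension finitary.
\<close>

lemma FinISA_extends_to_FinSA:
  fixes y :: "('x::finite) list \<Rightarrow> 'x list option"
  assumes y: "y \<in> carrier FinISA"
  obtains h where "h \<in> carrier FinSA" "\<And>u v. y u = Some v \<Longrightarrow> h u = Some v"
proof -
  have tree: "tree_map y"
    using y by (simp add: FinISA_iff)
  obtain l where l: "\<And>u v. y u = Some v \<Longrightarrow> drop l v = drop l u"
    using y unfolding FinISA_iff by blast
  have "\<exists>\<sigma>. inj \<sigma> \<and> (\<forall>x v. y (u @ [x]) = Some v \<longrightarrow> \<sigma> x = last v) \<and> (l \<le> length u \<longrightarrow> \<sigma> = id)" for u
  proof (cases "l \<le> length u")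
    case True
    have "last v = x" if v: "y (u @ [x]) = Some v" for x v
    proof -
      have "drop l v = drop l u @ [x]"
        using l[OF v] True by simp
      then show ?thesis
        by (metis append_is_Nil_conv drop_Nil last_drop last_snoc length_drop length_greater_0_conv
            not_Cons_self2 zero_less_diff)
    qed
    then show ?thesis by (intro exI[of _ id]) auto
  next
    case False
    define p where "p x = map_option last (y (u @ [x]))" for x
    have "inj_on p (dom p)"
    proof (rule inj_onI)
      fix x x' assume "x \<in> dom p" "p x = p x'"
      then obtain v v' where v: "y (u @ [x]) = Some v" "y (u @ [x']) = Some v'" "last v = last v'"
        by (auto simp: p_def)
      then obtain a b where "v = a @ [b]" "y u = Some a"
        using tree unfolding tree_map_def by blast
      moreover from v obtain a' b' where "v' = a' @ [b']" "y u = Some a'"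
        using tree unfolding tree_map_def by blast
      ultimately have "v = v'"
        using v(3) by simp
      then have "u @ [x] = u @ [x']"
        using FinISA_inj[OF y] v by blast
      then show "x = x'" by simp
    qed
    then obtain \<sigma> where "inj \<sigma>" "\<And>x b. p x = Some b \<Longrightarrow> \<sigma> x = b"
      using partial_injection_extends by blast
    with False show ?thesis
      by (intro exI[of _ \<sigma>]) (simp add: p_def)
  qed
  then obtain \<sigma> where \<sigma>: "\<And>u. inj (\<sigma> u)" "\<And>u x v. y (u @ [x]) = Some v \<Longrightarrow> \<sigma> u x = last v"
    "\<And>u. l \<le> length u \<Longrightarrow> \<sigma> u = id"
    by metis
  define k where "k u = map (\<lambda>i. \<sigma> (take i u) (u ! i)) [0..<length u]" for u
  have k_Nil: "k [] = []" and k_snoc: "k (u @ [x]) = k u @ [\<sigma> u x]" for u x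
    by (simp_all add: k_def nth_append)
  have k_length: "length (k u) = length u" for u
    by (simp add: k_def)
  have k_inj: "u = v" if "k u = k v" for u v
    using that
  proof (induction u arbitrary: v rule: rev_induct)
    case Nil
    then show ?case using k_length[of v] k_Nil by simp
  next
    case (snoc x u)
    have "v \<noteq> []"
      using snoc.prems by (auto simp: k_Nil k_snoc)
    then obtain v' x' where v: "v = v' @ [x']"
      by (metis rev_exhaust)
    then have "u = v'"
      using snoc by (simp add: k_snoc)
    then show ?case
      using snoc.prems v \<sigma>(1)[of u] by (simp add: k_snoc inj_eq)
  qed
  define h where "h u = Some (k u)" for u
  have "tree_map h"
    by (auto simp: tree_map_def h_def k_Nil k_snoc)
  moreover have "inj_on h (dom h)"
    by (auto simp: inj_on_def h_def k_inj)
  moreover have "drop l (k u) = drop l u" for u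
  proof (rule nth_equalityI)
    fix i assume "i < length (drop l (k u))"
    then have "l + i < length u"
      by (simp add: k_length)
    then show "drop l (k u) ! i = drop l u ! i"
      by (simp add: k_length) (simp add: k_def \<sigma>(3))
  qed (simp add: k_length)
  ultimately have "h \<in> carrier FinSA"
    by (auto simp: FinSA_iff FinISA_iff h_def)
  moreover have "h u = Some v" if "y u = Some v" for u v
    using that
  proof (induction u arbitrary: v rule: rev_induct)
    case Nil
    then show ?case using tree by (simp add: tree_map_def h_def k_Nil)
  next
    case (snoc x u)
    then obtain a b where "v = a @ [b]" "y u = Some a"
      using tree unfolding tree_map_def by blast
    then show ?case
      using snoc \<sigma>(2)[OF snoc.prems] by (simp add: h_def k_snoc)
  qed
  ultimately show thesis using that by blast
qed

section \<open>The two notions of conjugacy\<close>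

lemma FinSA_conjugate_trans:
  fixes a b c :: "('x::finite) list \<Rightarrow> 'x list option"
  assumes "FinSA_conjugate a b" "FinSA_conjugate b c"
  shows "FinSA_conjugate a c"
proof -
  obtain h k where hk: "h \<in> carrier FinSA" "k \<in> carrier FinSA"
    and a: "a = inv\<^bsub>FinSA\<^esub> h \<circ>\<^sub>m b \<circ>\<^sub>m h" and b: "b = inv\<^bsub>FinSA\<^esub> k \<circ>\<^sub>m c \<circ>\<^sub>m k"
    using assms by (auto simp: FinSA_conjugate_def)
  have "inv\<^bsub>FinSA\<^esub> (k \<circ>\<^sub>m h) = inv\<^bsub>FinSA\<^esub> h \<circ>\<^sub>m inv\<^bsub>FinSA\<^esub> k"
    using FinSA.inv_mult_group[OF hk(2,1)] by simp
  then have "a = inv\<^bsub>FinSA\<^esub> (k \<circ>\<^sub>m h) \<circ>\<^sub>m c \<circ>\<^sub>m (k \<circ>\<^sub>m h)"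
    by (simp add: a b map_comp_assoc)
  moreover have "k \<circ>\<^sub>m h \<in> carrier FinSA"
    using FinSA.m_closed[OF hk(2,1)] by simp
  ultimately show ?thesis
    unfolding FinSA_conjugate_def by (simp only: FinISA_mult) blast
qed

text \<open>
  An extension \<open>h\<close> of the intertwiner \<open>p\<close> satisfies \<open>h e = p = e' h\<close>, because \<open>p\<close> has
  the domain of \<open>e\<close> as its domain and the domain of \<open>e'\<close> as its range.  Hence
  \<open>b e' h = b p = p a = h e a = h a e\<close>.
\<close>

lemma primary_conjugate_imp_FinSA_conjugate:
  fixes a b :: "('x::finite) list \<Rightarrow> 'x list option"
  assumes "primary_conjugate FinISA a b"
  shows "FinSA_conjugate (a \<otimes>\<^bsub>FinISA\<^esub> idem_of FinISA a) (b \<otimes>\<^bsub>FinISA\<^esub> idem_of FinISA b)"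
proof -
  obtain x y where x: "x \<in> carrier FinISA" and y: "y \<in> carrier FinISA"
    and a: "a = x \<circ>\<^sub>m y" and b: "b = y \<circ>\<^sub>m x"
    using assms by (auto simp: primary_conjugate_def)
  have ac: "a \<in> carrier FinISA" and bc: "b \<in> carrier FinISA"
    using x y by (auto simp: a b FinISA_comp_closed)
  obtain s :: nat where s: "s \<ge> 1" "(a [^]\<^bsub>FinISA\<^esub> s) \<circ>\<^sub>m (a [^]\<^bsub>FinISA\<^esub> s) = a [^]\<^bsub>FinISA\<^esub> s"
    using FinISA_idempotent_power[OF ac] by blast
  obtain r :: nat where r: "r \<ge> 1" "(b [^]\<^bsub>FinISA\<^esub> r) \<circ>\<^sub>m (b [^]\<^bsub>FinISA\<^esub> r) = b [^]\<^bsub>FinISA\<^esub> r"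
    using FinISA_idempotent_power[OF bc] by blast
  define e where "e = a [^]\<^bsub>FinISA\<^esub> s"
  define e' where "e' = b [^]\<^bsub>FinISA\<^esub> r"
  have ec: "e \<in> carrier FinISA" "e' \<in> carrier FinISA"
    using ac bc by (auto simp: e_def e'_def)
  have idem: "e \<circ>\<^sub>m e = e" "e' \<circ>\<^sub>m e' = e'"
    using s r by (auto simp: e_def e'_def)
  \<comment> \<open>A common exponent for both idempotent powers.\<close>
  have e_pow: "e = (x \<otimes>\<^bsub>FinISA\<^esub> y) [^]\<^bsub>FinISA\<^esub> (s * r)"
    using FinISA.idempotent_nat_pow[of e r] ec idem r ac
    by (simp add: e_def FinISA.nat_pow_pow flip: a)
  have e'_pow: "e' = (y \<otimes>\<^bsub>FinISA\<^esub> x) [^]\<^bsub>FinISA\<^esub> (s * r)"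
    using FinISA.idempotent_nat_pow[of e' s] ec idem s bc
    by (simp add: e'_def FinISA.nat_pow_pow mult.commute flip: b)
  have sr: "s * r \<ge> 1"
    using s r by simp
  obtain p z where pz: "p \<in> carrier FinISA" "z \<in> carrier FinISA" "p \<circ>\<^sub>m e = p" "e' \<circ>\<^sub>m p = p"
    "z \<circ>\<^sub>m p = e" "p \<circ>\<^sub>m z = e'" "b \<circ>\<^sub>m p = p \<circ>\<^sub>m a"
    using FinISA.idempotent_power_intertwiner[OF x y sr e_pow _ e'_pow] idem
    by (auto simp: a b)
  have fix_e: "v = u" if "e u = Some v" for u v
    using FinISA_idempotent_fixes[OF ec(1) idem(1) that] .
  have fix_e': "v = u" if "e' u = Some v" for u v
    using FinISA_idempotent_fixes[OF ec(2) idem(2) that] .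
  obtain h where h: "h \<in> carrier FinSA" and ext: "\<And>u v. p u = Some v \<Longrightarrow> h u = Some v"
    using FinISA_extends_to_FinSA[OF pz(1)] by blast
  have he: "h \<circ>\<^sub>m e = p"
  proof
    fix u
    show "(h \<circ>\<^sub>m e) u = p u"
    proof (cases "e u")
      case None
      then show ?thesis
        using fun_cong[OF pz(3), of u] by simp
    next
      case (Some v)
      with fun_cong[OF pz(5), of u] obtain w where "p u = Some w"
        by (auto simp: map_comp_Some_iff)
      with Some fix_e[OF Some] show ?thesis
        by (simp add: ext)
    qed
  qed
  have eh: "e' \<circ>\<^sub>m h = p"
  proof
    fix u
    obtain v where v: "h u = Some v"
      using h by (auto simp: FinSA_iff)
    show "(e' \<circ>\<^sub>m h) u = p u"
    proof (cases "e' v")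
      case None
      have "p u = None"
      proof (rule ccontr)
        assume "p u \<noteq> None"
        then have "p u = Some v"
          using ext v by force
        then show False
          using fun_cong[OF pz(4), of u] None by simp
      qed
      with None v show ?thesis by simp
    next
      case (Some v')
      with fix_e' have e'v: "e' v = Some v" by blast
      with fun_cong[OF pz(6), of v] obtain w where w: "p w = Some v"
        by (auto simp: map_comp_Some_iff)
      then have "w = u"
        using FinISA_inj[of h w v u] ext v h by (simp add: FinSA_iff)
      with w v e'v show ?thesis by simp
    qed
  qed
  have comm: "e \<circ>\<^sub>m a = a \<circ>\<^sub>m e"
    using FinISA.nat_pow_comm[OF ac, of s 1] ac by (simp add: e_def)
  have "(b \<circ>\<^sub>m e') \<circ>\<^sub>m h = b \<circ>\<^sub>m p"
    by (simp add: map_comp_assoc eh)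
  also have "\<dots> = h \<circ>\<^sub>m (a \<circ>\<^sub>m e)"
    using pz(7) by (simp only: he[symmetric] comm[symmetric] map_comp_assoc)
  finally have key: "(b \<circ>\<^sub>m e') \<circ>\<^sub>m h = h \<circ>\<^sub>m (a \<circ>\<^sub>m e)" .
  have "inv\<^bsub>FinSA\<^esub> h \<circ>\<^sub>m h = Some"
    using FinSA.l_inv[OF h] by simp
  then have "a \<circ>\<^sub>m e = inv\<^bsub>FinSA\<^esub> h \<circ>\<^sub>m (b \<circ>\<^sub>m e') \<circ>\<^sub>m h"
    by (simp add: map_comp_assoc key[unfolded map_comp_assoc]) (simp flip: map_comp_assoc)
  moreover have "idem_of FinISA a = e" "idem_of FinISA b = e'"
    using FinISA_idem_of[OF ac s] FinISA_idem_of[OF bc r] by (simp_all add: e_def e'_def)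
  ultimately show ?thesis
    using h by (auto simp: FinSA_conjugate_def)
qed

lemma FinSA_conjugate_imp_primary_conjugate:
  fixes a b :: "('x::finite) list \<Rightarrow> 'x list option"
  assumes "FinSA_conjugate a b" "b \<in> carrier FinISA"
  shows "primary_conjugate FinISA a b"
proof -
  obtain h where h: "h \<in> carrier FinSA" and a: "a = inv\<^bsub>FinSA\<^esub> h \<circ>\<^sub>m b \<circ>\<^sub>m h"
    using assms(1) by (auto simp: FinSA_conjugate_def)
  have "inv\<^bsub>FinSA\<^esub> h \<in> carrier FinISA" "h \<in> carrier FinISA"
    using h FinSA.inv_closed[OF h] by (auto simp: FinSA_iff)
  moreover have "h \<circ>\<^sub>m inv\<^bsub>FinSA\<^esub> h = Some"
    using FinSA.r_inv[OF h] by simp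
  then have "b = h \<circ>\<^sub>m (inv\<^bsub>FinSA\<^esub> h \<circ>\<^sub>m b)"
    by (simp flip: map_comp_assoc)
  ultimately show ?thesis
    using a assms(2) unfolding primary_conjugate_def FinISA_mult
    by (intro bexI[of _ "inv\<^bsub>FinSA\<^esub> h \<circ>\<^sub>m b"] bexI[of _ h]) (auto intro: FinISA_comp_closed)
qed

lemma semigroup_conjugate_sym: "semigroup_conjugate S a b \<Longrightarrow> semigroup_conjugate S b a"
  unfolding semigroup_conjugate_def
  by (induction rule: tranclp_induct)
     (auto simp: primary_conjugate_def intro: tranclp_into_tranclp2)

text \<open>
  With \<open>d n\<close> the partial identity on the domain of \<open>f\<^sup>n\<close>, the product \<open>d n \<circ>\<^sub>m f\<close> is defined
  exactly where \<open>f\<^sup>n\<^sup>+\<^sup>1\<close> is.  So swapping the factors of \<open>f \<circ>\<^sub>m d n\<close> yields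
  \<open>f \<circ>\<^sub>m d (Suc n)\<close>, and an idempotent \<open>f\<^sup>t\<close> equals \<open>d t\<close>.
\<close>

lemma semigroup_conjugate_idempotent_power:
  assumes f: "f \<in> carrier FinISA"
    and idem: "(f [^]\<^bsub>FinISA\<^esub> t) \<circ>\<^sub>m (f [^]\<^bsub>FinISA\<^esub> t) = f [^]\<^bsub>FinISA\<^esub> (t::nat)"
  shows "semigroup_conjugate FinISA f (f \<circ>\<^sub>m (f [^]\<^bsub>FinISA\<^esub> t))"
proof -
  define d where "d n = Some |` dom (f [^]\<^bsub>FinISA\<^esub> n)" for n :: nat
  have d: "d n \<in> carrier FinISA" for n
    unfolding d_def
    by (rule partial_identity_in_FinISA)
       (use FinISA_pow_tree_map[OF f, of n] in \<open>auto simp: tree_map_def\<close>, blast)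
  have "d n \<circ>\<^sub>m f = f \<circ>\<^sub>m d (Suc n)" for n
  proof
    fix u
    show "(d n \<circ>\<^sub>m f) u = (f \<circ>\<^sub>m d (Suc n)) u"
      by (cases "f u") (auto simp: d_def restrict_map_def map_comp_def split: option.splits)
  qed
  then have step: "primary_conjugate FinISA (f \<circ>\<^sub>m d n) (f \<circ>\<^sub>m d (Suc n))" for n
    unfolding primary_conjugate_def FinISA_mult using f d by metis
  have d0: "d 0 = Some"
    by (simp add: d_def restrict_map_def)
  have "semigroup_conjugate FinISA f (f \<circ>\<^sub>m d n)" for n
    unfolding semigroup_conjugate_def
  proof (induction n)
    case 0
    have "primary_conjugate FinISA f f"
      unfolding primary_conjugate_def FinISA_mult using f Some_in_FinISA
      by (intro bexI[of _ f] bexI[of _ Some]) auto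
    then show ?case by (simp add: d0)
  next
    case (Suc n)
    then show ?case using step[of n] by (meson tranclp.trancl_into_trancl)
  qed
  moreover have "d t = f [^]\<^bsub>FinISA\<^esub> t"
  proof
    fix u
    show "d t u = (f [^]\<^bsub>FinISA\<^esub> t) u"
      using FinISA_idempotent_fixes[OF FinISA.nat_pow_closed[OF f] idem, of u]
      by (cases "(f [^]\<^bsub>FinISA\<^esub> t) u") (auto simp: d_def restrict_map_def)
  qed
  ultimately show ?thesis by metis
qed

lemma semigroup_conjugate_idem_of:
  fixes f :: "('x::finite) list \<Rightarrow> 'x list option"
  assumes f: "f \<in> carrier FinISA"
  shows "semigroup_conjugate FinISA f (f \<otimes>\<^bsub>FinISA\<^esub> idem_of FinISA f)"
    and "f \<otimes>\<^bsub>FinISA\<^esub> idem_of FinISA f \<in> carrier FinISA"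
proof -
  obtain t :: nat where t: "t \<ge> 1" "(f [^]\<^bsub>FinISA\<^esub> t) \<circ>\<^sub>m (f [^]\<^bsub>FinISA\<^esub> t) = f [^]\<^bsub>FinISA\<^esub> t"
    using FinISA_idempotent_power[OF f] by blast
  show "semigroup_conjugate FinISA f (f \<otimes>\<^bsub>FinISA\<^esub> idem_of FinISA f)"
    using semigroup_conjugate_idempotent_power[OF f t(2)] FinISA_idem_of[OF f t] by simp
  show "f \<otimes>\<^bsub>FinISA\<^esub> idem_of FinISA f \<in> carrier FinISA"
    using f FinISA_idem_of[OF f t] by (simp add: FinISA_comp_closed)
qed

theorem theorem8:
  fixes f g :: "('x::finite) list \<Rightarrow> 'x list option"
  assumes "f \<in> carrier FinISA" and "g \<in> carrier FinISA"
  shows "semigroup_conjugate FinISA f g \<longleftrightarrow>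
    FinSA_conjugate (f \<otimes>\<^bsub>FinISA\<^esub> idem_of FinISA f) (g \<otimes>\<^bsub>FinISA\<^esub> idem_of FinISA g)"
proof
  assume "semigroup_conjugate FinISA f g"
  then show "FinSA_conjugate (f \<otimes>\<^bsub>FinISA\<^esub> idem_of FinISA f) (g \<otimes>\<^bsub>FinISA\<^esub> idem_of FinISA g)"
    unfolding semigroup_conjugate_def
    by (induction rule: tranclp_induct)
       (blast intro: primary_conjugate_imp_FinSA_conjugate FinSA_conjugate_trans)+
next
  assume "FinSA_conjugate (f \<otimes>\<^bsub>FinISA\<^esub> idem_of FinISA f) (g \<otimes>\<^bsub>FinISA\<^esub> idem_of FinISA g)"
  then have "primary_conjugate FinISA (f \<otimes>\<^bsub>FinISA\<^esub> idem_of FinISA f) (g \<otimes>\<^bsub>FinISA\<^esub> idem_of FinISA g)"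
    using FinSA_conjugate_imp_primary_conjugate semigroup_conjugate_idem_of(2)[OF assms(2)] by blast
  then show "semigroup_conjugate FinISA f g"
    using semigroup_conjugate_idem_of(1)[OF assms(1)]
      semigroup_conjugate_sym[OF semigroup_conjugate_idem_of(1)[OF assms(2)]]
    unfolding semigroup_conjugate_def by (meson tranclp.trancl_into_trancl tranclp_trans)
qed

end
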